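(* Let $d\ge 1$, $M\ge 1$, and let $\mathscr{H}(\lambda)=H_0+\sum_{k=1}^M\lambda_kH_k$ be an $M$-parameter Hamiltonian model acting on a $d$-dimensional complex Hilbert space $\mathcal{H}_d$. There exists a non-trivial proper subspace $V\subset\mathcal{H}_d$ (i.e. $\{0\}\ne V\ne\mathcal{H}_d$) with $\mathscr{H}(\lambda)V\subseteq V$ for all $\lambda\in\mathbb{R}^M$ if and only if the subalgebra $\mathscr{A}(\mathscr{H})$ generated by $\mathrm{Coeff}(\mathscr{H})$ is a proper subalgebra of $L(\mathcal{H}_d)$, that is, $\dim(\mathscr{A}(\mathscr{H}))<\dim(L(\mathcal{H}_d))$.
   Context: $L(\mathcal{H}_d)$ is the algebra of all linear operators on $\mathcal{H}_d\cong\mathbb{C}^d$. An $M$-parameter Hamiltonian model is a function $\mathscr{H}:\mathbb{R}^M\to L(\mathcal{H}_d)$, $\mathscr{H}(\lambda)=H_0+\sum_{k=1}^M\lambda_kH_k$, where $H_0,\dots,H_M$ are fixed self-adjoint operators on $\mathcal{H}_d$. $\mathrm{Coeff}(\mathscr{H})$ denotes the image $\mathscr{H}(\beta)$ of an affine basis $\beta$ of $\mathbb{R}^M$ ($M+1$ affinely independent points), or the set $\mathscr{H}_L(\beta_* )\cup\mathscr{H}(\beta\setminus\beta_* )$ with $\beta_*\subset\beta$ a linear basis of $\mathbb{R}^M$ and $\mathscr{H}_L(\lambda)=\sum_{k=1}^M\lambda_kH_k$; for instance one may take $\mathrm{Coeff}(\mathscr{H})=\{H_0,H_1,\dots,H_M\}$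 (all these choices generate the same algebra). For a finite set $S=\{A_1,\dots,A_K\}\subset L(\mathcal{H}_d)$, $\mathscr{A}(S)$ is the (unital) subalgebra of all $p(A_1,\dots,A_K)$ with $p$ a complex polynomial in $K$ non-commuting variables (constants allowed), and $\mathscr{A}(\mathscr{H}):=\mathscr{A}(\mathrm{Coeff}(\mathscr{H}))$. Dimensions are over $\mathbb{C}$. *)

theory Defs
  imports "HOL-Analysis.Analysis" "HOL-Library.Function_Algebras" "HOL-Library.Poly_Mapping"
begin

text \<open>
  The Hilbert space is \<open>complex ^ 'n\<close>, with \<open>d = CARD('n)\<close>, and the parameter space is
  \<open>real ^ 'm\<close>, with \<open>M = CARD('m)\<close>; both numbers are at least 1 because types are inhabited.
  The complex vector space structure is the one given by \<open>(*s)\<close> (library prefix \<open>vec\<close>).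
  Functions are added pointwise (\<open>Function_Algebras\<close>); the product of operators is
  composition, not the pointwise product of that theory.
\<close>

type_synonym 'n endo = "complex ^ 'n \<Rightarrow> complex ^ 'n"

definition lin_ops :: "('n::finite) endo set" where
  "lin_ops = {A. Vector_Spaces.linear (*s) (*s) A}"

definition op_scale :: "complex \<Rightarrow> ('n::finite) endo \<Rightarrow> 'n endo" where
  "op_scale c A = (\<lambda>x. c *s A x)"

global_interpretation op: vector_space "op_scale :: complex \<Rightarrow> ('n::finite) endo \<Rightarrow> 'n endo"
  by unfold_locales
    (simp_all add: op_scale_def fun_eq_iff vec_eq_iff plus_fun_def algebra_simps)

definition cinner :: "complex ^ ('n::finite) \<Rightarrow> complex ^ 'n \<Rightarrow> complex" where
  "cinner x y = (\<Sum>i\<in>UNIV. cnj (x $ i) * y $ i)"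

definition self_adjoint :: "('n::finite) endo \<Rightarrow> bool" where
  "self_adjoint A \<longleftrightarrow> A \<in> lin_ops \<and> (\<forall>x y. cinner (A x) y = cinner x (A y))"

definition ham_lin :: "(('m::finite) \<Rightarrow> ('n::finite) endo) \<Rightarrow> real ^ 'm \<Rightarrow> 'n endo" where
  "ham_lin H l = (\<Sum>k\<in>UNIV. op_scale (of_real (l $ k)) (H k))"

definition ham :: "('n::finite) endo \<Rightarrow> (('m::finite) \<Rightarrow> 'n endo) \<Rightarrow> real ^ 'm \<Rightarrow> 'n endo" where
  "ham H0 H l = H0 + ham_lin H l"

definition affine_basis :: "(real ^ ('m::finite)) set \<Rightarrow> bool" where
  "affine_basis B \<longleftrightarrow> card B = CARD('m) + 1 \<and> \<not> affine_dependent B"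

definition linear_basis :: "(real ^ ('m::finite)) set \<Rightarrow> bool" where
  "linear_basis B \<longleftrightarrow> independent B \<and> span B = UNIV"

text \<open>
  \<open>is_coeff H0 H S\<close> says that \<open>S\<close> is one of the admissible choices of the coefficient set of
  the model; the choice is not unique. Taking \<open>B = {0} \<union> Basis\<close> and \<open>C = Basis\<close> in the second
  alternative gives \<open>S = {H0} \<union> range H\<close>.
\<close>

definition is_coeff ::
  "('n::finite) endo \<Rightarrow> (('m::finite) \<Rightarrow> 'n endo) \<Rightarrow> 'n endo set \<Rightarrow> bool" where
  "is_coeff H0 H S \<longleftrightarrow>
    (\<exists>B. affine_basis B \<and> S = ham H0 H ` B) \<or>
    (\<exists>B C. affine_basis B \<and> linear_basis C \<and> C \<subset> B \<and>
           S = ham_lin H ` C \<union> ham H0 H ` (B - C))"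

text \<open>
  A complex polynomial in non-commuting variables from \<open>'v\<close> is a finitely supported map from
  words (the monomials) to coefficients; the empty word is the constant monomial.
\<close>

type_synonym 'v ncpoly = "'v list \<Rightarrow>\<^sub>0 complex"

definition ncpoly_vars :: "'v ncpoly \<Rightarrow> 'v set" where
  "ncpoly_vars p = (\<Union>w\<in>Poly_Mapping.keys p. set w)"

primrec word_eval :: "('v \<Rightarrow> ('n::finite) endo) \<Rightarrow> 'v list \<Rightarrow> 'n endo" where
  "word_eval A [] = id"
| "word_eval A (v # w) = A v \<circ> word_eval A w"

definition ncpoly_eval :: "('v \<Rightarrow> ('n::finite) endo) \<Rightarrow> 'v ncpoly \<Rightarrow> 'n endo" where
  "ncpoly_eval A p =
    (\<Sum>w\<in>Poly_Mapping.keys p. op_scale (Poly_Mapping.lookup p w) (word_eval A w))"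

text \<open>
  For \<open>S = {A\<^sub>1, \<dots>, A\<^sub>K}\<close> the variables are indexed by the elements of \<open>S\<close>
  themselves, and each variable is replaced by the operator that indexes it.
\<close>

definition gen_alg :: "('n::finite) endo set \<Rightarrow> 'n endo set" where
  "gen_alg S = {ncpoly_eval (\<lambda>A. A) p | p. ncpoly_vars p \<subseteq> S}"

definition unital_subalgebra :: "('n::finite) endo set \<Rightarrow> bool" where
  "unital_subalgebra \<A> \<longleftrightarrow>
    \<A> \<subseteq> lin_ops \<and> op.subspace \<A> \<and> id \<in> \<A> \<and> (\<forall>A\<in>\<A>. \<forall>B\<in>\<A>. A \<circ> B \<in> \<A>)"

definition proper_subalgebra :: "('n::finite) endo set \<Rightarrow> bool" where
  "proper_subalgebra \<A> \<longleftrightarrow> unital_subalgebra \<A> \<and> \<A> \<noteq> lin_ops"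

end

theory Submission
  imports Defs "HOL-Computational_Algebra.Fundamental_Theorem_Algebra"
begin

text \<open>
  Each coefficient set is an affine (or linear) frame of the model, so a subspace is invariant
  under all \<open>\<H>(\<lambda>)\<close> iff it is invariant under the generated algebra, and the claim becomes
  Burnside's theorem: an irreducible unital algebra \<open>\<A>\<close> of operators on \<open>\<complex>\<^sup>d\<close> contains every
  operator. For \<open>0 \<noteq> T \<in> \<A>\<close> with kernel of maximal dimension and \<open>S \<in> \<A>\<close>, an eigenvalue \<open>c\<close> of
  \<open>T S\<close> on the range of \<open>T\<close> makes the kernel of \<open>(T S - c) T\<close> strictly larger, so \<open>T S T = c T\<close>.
  As \<open>\<A>\<close> is transitive on nonzero vectors, this forces \<open>T\<close> to have rank one, and multiplying \<open>T\<close> by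
  elements of \<open>\<A>\<close> on both sides yields all operators of rank one.
\<close>

lemma sum_fun_apply: "(\<Sum>i\<in>I. f i) x = (\<Sum>i\<in>I. f i x)"
  for f :: "'i \<Rightarrow> 'a \<Rightarrow> 'b::comm_monoid_add"
  by (induction I rule: infinite_finite_induct) simp_all

lemma op_scale_apply [simp]: "op_scale c A x = c *s A x"
  by (simp add: op_scale_def)

subsection \<open>Eigenvectors in invariant subspaces\<close>

text \<open>\<open>poly_orbit L w p\<close> is \<open>p(L) w\<close>, computed by Horner's scheme.\<close>

definition poly_orbit :: "('n::finite) endo \<Rightarrow> complex ^ 'n \<Rightarrow> complex poly \<Rightarrow> complex ^ 'n" where
  "poly_orbit L w p = fold_coeffs (\<lambda>a v. a *s w + L v) p 0"

context
  fixes L :: "('n::finite) endo"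
  assumes L: "Vector_Spaces.linear (*s) (*s) L"
begin

lemma poly_orbit_0 [simp]: "poly_orbit L w 0 = 0"
  by (simp add: poly_orbit_def)

text \<open>\<open>fold_coeffs\<close> does not step through \<open>pCons 0 0\<close>; there both
  sides vanish because \<open>L 0 = 0\<close>, so Horner's recursion holds without a side
  condition.\<close>

lemma poly_orbit_pCons [simp]: "poly_orbit L w (pCons a p) = a *s w + L (poly_orbit L w p)"
  using vec.linear_0[OF L] by (cases "a = 0 \<and> p = 0") (auto simp: poly_orbit_def)

lemma poly_orbit_add: "poly_orbit L w (p + q) = poly_orbit L w p + poly_orbit L w q"
proof (induction p arbitrary: q)
  case 0
  then show ?case by simp
next
  case (pCons a p)
  show ?case
    by (cases q) (simp add: pCons.IH vec.linear_add[OF L] vec.scale_left_distrib)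
qed

lemma poly_orbit_smult: "poly_orbit L w (smult c p) = c *s poly_orbit L w p"
  by (induction p) (simp_all add: vec.linear_scale[OF L] vec.scale_right_distrib)

lemma poly_orbit_monom: "poly_orbit L w (monom c i) = c *s (L ^^ i) w"
  by (induction i) (simp_all add: monom_0 monom_Suc vec.linear_0[OF L] vec.linear_scale[OF L])

lemma poly_orbit_sum: "poly_orbit L w (\<Sum>i\<in>I. f i) = (\<Sum>i\<in>I. poly_orbit L w (f i))"
  by (induction I rule: infinite_finite_induct) (simp_all add: poly_orbit_add)

text \<open>A factor \<open>X - c\<close> of the polynomial acts as \<open>L - c\<close>: the
  product splits as \<open>- c q + X q\<close>, and multiplication by \<open>X\<close> is
  \<open>pCons 0\<close>.\<close>

lemma poly_orbit_linear_factor: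
  "poly_orbit L w ([:- c, 1:] * q) = L (poly_orbit L w q) - c *s poly_orbit L w q"
proof -
  have "[:- c, 1:] * q = smult (- c) q + pCons 0 q" by simp
  then show ?thesis
    by (simp only: poly_orbit_add poly_orbit_smult poly_orbit_pCons) simp
qed

text \<open>The \<open>d + 1\<close> iterates \<open>w, L w, ..., L^d w\<close> cannot be linearly
  independent as a family; the coefficients of a dependence form the polynomial.\<close>

lemma ex_poly_orbit_eq_0: "\<exists>p. p \<noteq> 0 \<and> poly_orbit L w p = 0"
proof (cases "inj_on (\<lambda>i. (L ^^ i) w) {..CARD('n)}")
  case False
  then obtain i j where ij: "i \<noteq> j" "(L ^^ i) w = (L ^^ j) w"
    by (auto simp: inj_on_def)
  \<comment> \<open>Repeated iterates are invisible to dependence of the set \<open>?T\<close>, so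
    they get their own annihilator \<open>X^i - X^j\<close>.\<close>
  then have "coeff (monom 1 i + monom (- 1) j :: complex poly) i \<noteq> 0"
    by simp
  then have "monom 1 i + monom (- 1) j \<noteq> (0 :: complex poly)"
    by (metis coeff_0)
  moreover have "poly_orbit L w (monom 1 i + monom (- 1) j) = 0"
    using ij by (simp add: poly_orbit_add poly_orbit_monom)
  ultimately show ?thesis by blast
next
  case True
  let ?T = "(\<lambda>i. (L ^^ i) w) ` {..CARD('n)}"
  have "card ?T = CARD('n) + 1"
    using True by (simp add: card_image)
  moreover have "vec.dim ?T \<le> CARD('n)"
    by (rule dim_subset_UNIV_cart_gen)
  ultimately have "vec.dependent ?T"
    using vec.dim_eq_card_independent[of ?T] by fastforce
  then obtain u v where u: "v \<in> ?T" "u v \<noteq> 0" "(\<Sum>v\<in>?T. u v *s v) = 0"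
    by (auto simp: vec.dependent_finite)
  define p where "p = (\<Sum>i\<le>CARD('n). monom (u ((L ^^ i) w)) i)"
  have "poly_orbit L w p = 0"
    using u(3) True by (simp add: p_def poly_orbit_sum poly_orbit_monom sum.reindex)
  moreover obtain i where i: "i \<le> CARD('n)" "v = (L ^^ i) w"
    using u(1) by auto
  have "coeff p i = u v"
    using i by (simp add: p_def coeff_sum)
  then have "p \<noteq> 0"
    using u(2) by auto
  ultimately show ?thesis by blast
qed

text \<open>Take a nonzero \<open>p\<close> with \<open>p(L) w = 0\<close> and split off a root,
  \<open>p = (X - c) q\<close>. Either \<open>q(L) w\<close> is nonzero and thus an eigenvector for
  \<open>c\<close>, lying in \<open>W\<close> by invariance, or \<open>q\<close> is an annihilator
  of smaller degree.\<close>

lemma ex_eigenvector_in_subspace: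
  assumes W: "vec.subspace W" "L ` W \<subseteq> W" "w \<in> W" "w \<noteq> 0"
  shows "\<exists>v c. v \<in> W \<and> v \<noteq> 0 \<and> L v = c *s v"
proof -
  have mem: "poly_orbit L w p \<in> W" for p
    by (induction p) (use W in \<open>auto simp: vec.subspace_0 vec.subspace_add vec.subspace_scale\<close>)
  have "p \<noteq> 0 \<Longrightarrow> poly_orbit L w p = 0 \<Longrightarrow> ?thesis" for p
  proof (induction "degree p" arbitrary: p rule: less_induct)
    case less
    \<comment> \<open>A nonzero constant cannot annihilate \<open>w \<noteq> 0\<close>, so
      \<open>p\<close> has a complex root.\<close>
    have "degree p \<noteq> 0"
    proof
      assume "degree p = 0"
      then obtain a where "p = [:a:]" by (rule degree_eq_zeroE)
      then show False using less.prems W(4) by (simp add: vec.linear_0[OF L])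
    qed
    then obtain c where "poly p c = 0"
      using fundamental_theorem_of_algebra[of p] by (auto simp: constant_degree)
    then obtain q where q: "p = [:- c, 1:] * q"
      by (auto simp: poly_eq_0_iff_dvd dvd_def)
    then have "q \<noteq> 0" using less.prems(1) by auto
    then have "degree q < degree p"
      unfolding q by (subst degree_mult_eq) auto
    show ?case
    proof (cases "poly_orbit L w q = 0")
      case True
      then show ?thesis using less.hyps \<open>degree q < degree p\<close> \<open>q \<noteq> 0\<close> by blast
    next
      case False
      moreover have "L (poly_orbit L w q) = c *s poly_orbit L w q"
        using less.prems(2) poly_orbit_linear_factor[of w c q] q by simp
      ultimately show ?thesis using mem by blast
    qed
  qed
  moreover obtain p where "p \<noteq> 0" "poly_orbit L w p = 0"
    using ex_poly_orbit_eq_0[of w] by blast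
  ultimately show ?thesis by simp
qed

end

subsection \<open>Burnside's theorem\<close>

lemma linear_combination_axis: "x = (\<Sum>i\<in>UNIV. x $ i *s axis i 1)"
  for x :: "complex ^ 'n::finite"
  by (simp add: basis_expansion)

lemma linear_image_expansion:
  fixes L :: "('n::finite) endo"
  assumes "Vector_Spaces.linear (*s) (*s) L"
  shows "L x = (\<Sum>i\<in>UNIV. x $ i *s L (axis i 1))"
  by (subst linear_combination_axis[of x])
    (simp add: vec.linear_sum[OF assms] vec.linear_scale[OF assms])

text \<open>This is the matrix \<open>a u^T\<close>. The pairing is bilinear rather than
  \<open>cinner\<close>, so the operator depends complex-linearly on \<open>u\<close>.\<close>

definition rank_one :: "complex ^ 'n \<Rightarrow> complex ^ ('n::finite) \<Rightarrow> 'n endo" where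
  "rank_one a u = (\<lambda>x. (\<Sum>i\<in>UNIV. u $ i * x $ i) *s a)"

lemma linear_rank_one: "Vector_Spaces.linear (*s) (*s) (rank_one a u)"
  by unfold_locales
    (simp_all add: rank_one_def vec_eq_iff algebra_simps sum.distrib sum_distrib_left)

lemma rank_one_axis: "rank_one a (axis i 1) x = x $ i *s a"
proof -
  have "(\<Sum>j\<in>UNIV. axis i 1 $ j * x $ j) = (\<Sum>j\<in>UNIV. if j = i then x $ i else 0)"
    by (rule sum.cong) (auto simp: axis_def)
  then show ?thesis by (simp add: rank_one_def)
qed

text \<open>Extend a basis of \<open>U\<close> by some \<open>v\<close> outside \<open>U\<close>,
  and let \<open>g\<close> kill the basis and fix \<open>v\<close>. A coordinate of \<open>g\<close>
  in which \<open>v\<close> is nonzero is a nonzero functional vanishing on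
  \<open>U\<close>.\<close>

lemma ex_orthogonal_to_proper_subspace:
  fixes U :: "(complex ^ 'n::finite) set"
  assumes "vec.subspace U" "U \<noteq> UNIV"
  shows "\<exists>x. x \<noteq> 0 \<and> (\<forall>u\<in>U. (\<Sum>i\<in>UNIV. u $ i * x $ i) = 0)"
proof -
  obtain v where v: "v \<notin> U" using assms(2) by auto
  obtain B where B: "B \<subseteq> U" "vec.independent B" "U \<subseteq> vec.span B" "card B = vec.dim U"
    by (rule vec.basis_exists)
  have "vec.span B = U"
    using vec.span_minimal[OF B(1) assms(1)] B(3) by (rule subset_antisym)
  then have "vec.independent (insert v B)"
    using v B(2) by (simp add: vec.independent_insertI)
  then obtain g :: "complex ^ 'n \<Rightarrow> complex ^ 'n" where
    g: "Vector_Spaces.linear (*s) (*s) g" "\<forall>x\<in>insert v B. g x = (if x = v then v else 0)"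
    using vec.linear_independent_extend[of "insert v B" "\<lambda>x. if x = v then v else 0"] by blast
  have "v \<noteq> 0" using v assms(1) vec.subspace_0 by auto
  then obtain j where j: "v $ j \<noteq> 0" by (auto simp: vec_eq_iff)
  \<comment> \<open>The vector \<open>x\<close> lists the values of this functional on the standard
    basis, so pairing with \<open>x\<close> gives the functional.\<close>
  define x :: "complex ^ 'n" where "x = (\<chi> i. g (axis i 1) $ j)"
  have gx: "g u $ j = (\<Sum>i\<in>UNIV. u $ i * x $ i)" for u
    by (subst linear_image_expansion[OF g(1)]) (simp add: x_def)
  have "g u = 0" if "u \<in> vec.span B" for u
    using vec.linear_eq_0_on_span[OF g(1) _ that] g(2) v B(1) by (metis insert_iff subsetD)
  then have "\<forall>u\<in>U. (\<Sum>i\<in>UNIV. u $ i * x $ i) = 0"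
    using B(3) gx by (metis subsetD zero_index)
  moreover have "x \<noteq> 0"
    using gx[of v] g(2) j by auto
  ultimately show ?thesis by blast
qed

theorem Burnside:
  fixes \<A> :: "('n::finite) endo set"
  assumes alg: "unital_subalgebra \<A>"
    and irred: "\<And>V. \<lbrakk>vec.subspace V; \<forall>A\<in>\<A>. A ` V \<subseteq> V\<rbrakk> \<Longrightarrow> V = {0} \<or> V = UNIV"
  shows "\<A> = lin_ops"
proof -
  have lin: "Vector_Spaces.linear (*s) (*s) A" if "A \<in> \<A>" for A
    using alg that by (auto simp: unital_subalgebra_def lin_ops_def)
  have sub: "op.subspace \<A>" and one: "id \<in> \<A>"
    and comp: "\<And>A B. A \<in> \<A> \<Longrightarrow> B \<in> \<A> \<Longrightarrow> A \<circ> B \<in> \<A>"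
    using alg by (auto simp: unital_subalgebra_def)
  \<comment> \<open>The orbit of \<open>x\<close> is an invariant subspace containing
    \<open>x = id x\<close>, hence it is the whole space by irreducibility.\<close>
  have transitive: "\<exists>A\<in>\<A>. A x = y" if "x \<noteq> 0" for x y
  proof -
    let ?V = "(\<lambda>A. A x) ` \<A>"
    have "vec.subspace ?V"
      unfolding vec.subspace_def
    proof (intro conjI ballI allI)
      show "0 \<in> ?V"
        using op.subspace_0[OF sub] by (rule rev_image_eqI) simp
    next
      fix a b assume "a \<in> ?V" "b \<in> ?V"
      then obtain A B where "A \<in> \<A>" "a = A x" "B \<in> \<A>" "b = B x" by auto
      then show "a + b \<in> ?V"
        using op.subspace_add[OF sub, of A B] by (intro rev_image_eqI[of "A + B"]) simp_all
    next
      fix c a assume "a \<in> ?V"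
      then obtain A where "A \<in> \<A>" "a = A x" by auto
      then show "c *s a \<in> ?V"
        using op.subspace_scale[OF sub, of A c] by (intro rev_image_eqI[of "op_scale c A"]) simp_all
    qed
    moreover have "\<forall>A\<in>\<A>. A ` ?V \<subseteq> ?V"
    proof clarify
      fix A B assume "A \<in> \<A>" "B \<in> \<A>"
      then show "A (B x) \<in> ?V"
        using comp by (intro rev_image_eqI[of "A \<circ> B"]) simp_all
    qed
    moreover have "x \<in> ?V" using one by (rule rev_image_eqI) simp
    ultimately have "?V = UNIV" using irred[of ?V] that by blast
    then show ?thesis by (metis UNIV_I image_iff)
  qed
  let ?ker = "\<lambda>T :: 'n endo. {x. T x = 0}"
  have ker: "vec.subspace (?ker T)" if "T \<in> \<A>" for T
    by (auto simp: vec.subspace_def vec.linear_0 vec.linear_add vec.linear_scale lin[OF that])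
  \<comment> \<open>The space is nonzero, so \<open>id\<close> is a nonzero element from which the
    maximization can start; kernel dimensions stay below \<open>CARD('n) + 1\<close>.\<close>
  have "id \<noteq> (0 :: 'n endo)"
    by (auto simp: fun_eq_iff intro: exI[of _ "axis undefined 1"])
  then obtain T where T: "T \<in> \<A>" "T \<noteq> 0"
    and max: "\<And>N. N \<in> \<A> \<Longrightarrow> N \<noteq> 0 \<Longrightarrow> vec.dim (?ker N) \<le> vec.dim (?ker T)"
    using ex_has_greatest_nat[of "\<lambda>T. T \<in> \<A> \<and> T \<noteq> 0" id "\<lambda>T. vec.dim (?ker T)" "CARD('n) + 1"]
      one dim_subset_UNIV_cart_gen[of "?ker _"] by (auto simp: less_Suc_eq_le)
  have scalar: "\<exists>c. \<forall>x. T (S (T x)) = c *s T x" if S: "S \<in> \<A>" for S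
  proof -
    have TS: "T \<circ> S \<in> \<A>" using T S comp by blast
    obtain x where x: "T x \<noteq> 0" using T(2) by (auto simp: fun_eq_iff)
    \<comment> \<open>The range of \<open>T\<close> is a subspace mapped into itself by
      \<open>T \<circ> S\<close>, and it contains \<open>T x \<noteq> 0\<close>.\<close>
    have "\<exists>v c. v \<in> range T \<and> v \<noteq> 0 \<and> (T \<circ> S) v = c *s v"
      by (rule ex_eigenvector_in_subspace[OF lin[OF TS], of _ "T x"])
        (use x vec.linear_subspace_image[OF lin[OF T(1)] vec.subspace_UNIV] in auto)
    then obtain z c where z: "T z \<noteq> 0" "T (S (T z)) = c *s T z" by auto
    define N where "N = (T \<circ> S \<circ> T) + op_scale (- c) T"
    have N: "N \<in> \<A>"
      unfolding N_def using TS T comp by (intro op.subspace_add[OF sub] op.subspace_scale[OF sub]) auto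
    have "?ker T \<subset> ?ker N"
    proof
      show "?ker T \<subseteq> ?ker N"
        by (auto simp: N_def vec.linear_0[OF lin[OF T(1)]] vec.linear_0[OF lin[OF S]])
      have "z \<in> ?ker N - ?ker T" using z by (simp add: N_def)
      then show "?ker T \<noteq> ?ker N" by blast
    qed
    then have "vec.dim (?ker T) < vec.dim (?ker N)"
      using ker T(1) N by (metis vec.dim_psubset vec.span_eq_iff)
    then have "N = 0" using max[OF N] by fastforce
    then show ?thesis
      by (intro exI[of _ c]) (auto simp: N_def fun_eq_iff)
  qed
  obtain x1 where x1: "T x1 \<noteq> 0" using T(2) by (auto simp: fun_eq_iff)
  \<comment> \<open>Writing \<open>x = S (T x1)\<close> by transitivity turns \<open>T x\<close>
    into \<open>T S T x1\<close>, a multiple of \<open>T x1\<close>.\<close>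
  have "\<exists>c. T x = c *s T x1" for x
  proof -
    obtain S where "S \<in> \<A>" "S (T x1) = x" using transitive[OF x1] by blast
    then show ?thesis using scalar by metis
  qed
  then obtain f where f: "\<And>x. T x = f x *s T x1" by metis
  \<comment> \<open>The function \<open>f\<close> comes from a pointwise choice; its values on the
    standard basis suffice, since \<open>T\<close> is linear.\<close>
  define u0 :: "complex ^ 'n" where "u0 = (\<chi> i. f (axis i 1))"
  have T_eq: "T x = rank_one (T x1) u0 x" for x
  proof -
    have "T x = (\<Sum>i\<in>UNIV. x $ i *s T (axis i 1))"
      by (rule linear_image_expansion[OF lin[OF T(1)]])
    also have "\<dots> = (\<Sum>i\<in>UNIV. (u0 $ i * x $ i) *s T x1)"
      by (rule sum.cong[OF refl], subst f) (simp add: u0_def mult.commute)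
    also have "\<dots> = rank_one (T x1) u0 x"
      by (simp add: rank_one_def vec.scale_sum_left)
    finally show ?thesis .
  qed
  \<comment> \<open>\<open>U\<close> collects the functionals \<open>u\<close> for which every
    operator \<open>a u^T\<close> lies in the algebra; once \<open>U\<close> is everything, all
    rank-one operators are available.\<close>
  define U where "U = {u. \<forall>a. rank_one a u \<in> \<A>}"
  have "vec.subspace U"
    unfolding vec.subspace_def
  proof (intro conjI ballI allI)
    have "rank_one a 0 = 0" for a :: "complex ^ 'n" by (simp add: rank_one_def fun_eq_iff)
    then show "0 \<in> U" using op.subspace_0[OF sub] by (simp add: U_def)
  next
    fix u v assume "u \<in> U" "v \<in> U"
    moreover have "rank_one a (u + v) = rank_one a u + rank_one a v" for a
      by (simp add: rank_one_def fun_eq_iff vec.scale_left_distrib sum.distrib distrib_right)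
    ultimately show "u + v \<in> U" using op.subspace_add[OF sub] by (simp add: U_def)
  next
    fix c u assume "u \<in> U"
    moreover have "rank_one a (c *s u) = op_scale c (rank_one a u)" for a
      by (simp add: rank_one_def fun_eq_iff sum_distrib_left mult.assoc)
    ultimately show "c *s u \<in> U" using op.subspace_scale[OF sub] by (simp add: U_def)
  qed
  have "U = UNIV"
  proof (rule ccontr)
    assume "U \<noteq> UNIV"
    then obtain y where y: "y \<noteq> 0" "\<And>u. u \<in> U \<Longrightarrow> (\<Sum>i\<in>UNIV. u $ i * y $ i) = 0"
      using ex_orthogonal_to_proper_subspace[OF \<open>vec.subspace U\<close>] by metis
    \<comment> \<open>If \<open>U\<close> were proper, \<open>y \<noteq> 0\<close> would be
      annihilated by it. The choice of \<open>S\<close> gives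
      \<open>T S y = T x1 \<noteq> 0\<close>, while the functional of \<open>T S\<close> will turn
      out to lie in \<open>U\<close>.\<close>
    obtain S where S: "S \<in> \<A>" "S y = x1" using transitive[OF y(1)] by blast
    \<comment> \<open>This is the transpose of \<open>S\<close> applied to \<open>u0\<close>, the
      functional of \<open>T \<circ> S\<close>.\<close>
    define u where "u = (\<chi> i. \<Sum>k\<in>UNIV. u0 $ k * S (axis i 1) $ k)"
    have u: "(\<Sum>i\<in>UNIV. u $ i * x $ i) = (\<Sum>k\<in>UNIV. u0 $ k * S x $ k)" for x
    proof -
      have "S x $ k = (\<Sum>i\<in>UNIV. x $ i * S (axis i 1) $ k)" for k
        by (subst linear_image_expansion[OF lin[OF S(1)], of x]) simp
      then have "(\<Sum>k\<in>UNIV. u0 $ k * S x $ k)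
          = (\<Sum>k\<in>UNIV. \<Sum>i\<in>UNIV. u0 $ k * (x $ i * S (axis i 1) $ k))"
        by (simp only: sum_distrib_left)
      also have "\<dots> = (\<Sum>i\<in>UNIV. \<Sum>k\<in>UNIV. u0 $ k * (x $ i * S (axis i 1) $ k))"
        by (rule sum.swap)
      also have "\<dots> = (\<Sum>i\<in>UNIV. u $ i * x $ i)"
        by (rule sum.cong[OF refl]) (simp add: u_def sum_distrib_left sum_distrib_right mult_ac)
      finally show ?thesis by (rule sym)
    qed
    have "u \<in> U"
      unfolding U_def
    proof (intro CollectI allI)
      fix a
      \<comment> \<open>Multiplying from the left moves the range vector \<open>T x1\<close> to the
        prescribed \<open>a\<close> and leaves the functional unchanged.\<close>
      obtain A where A: "A \<in> \<A>" "A (T x1) = a" using transitive[OF x1] by blast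
      have "rank_one a u = A \<circ> T \<circ> S"
      proof
        fix x
        have "A (T (S x)) = A (rank_one (T x1) u0 (S x))" by (subst T_eq[of "S x"]) (rule refl)
        then show "rank_one a u x = (A \<circ> T \<circ> S) x"
          by (simp add: rank_one_def u vec.linear_scale[OF lin[OF A(1)]] A(2))
      qed
      then show "rank_one a u \<in> \<A>" using A T S comp by auto
    qed
    then have "(\<Sum>k\<in>UNIV. u0 $ k * S y $ k) = 0" using y(2) u by metis
    then have "rank_one (T x1) u0 x1 = 0" using S by (simp add: rank_one_def)
    with T_eq[of x1] have "T x1 = 0" by (rule trans)
    then show False using x1 by contradiction
  qed
  have "L \<in> \<A>" if "L \<in> lin_ops" for L
  proof -
    have L: "Vector_Spaces.linear (*s) (*s) L" using that by (simp add: lin_ops_def)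
    \<comment> \<open>A matrix is the sum of its columns, each multiplied by the matching coordinate
      functional.\<close>
    have "L = (\<Sum>i\<in>UNIV. rank_one (L (axis i 1)) (axis i 1))"
    proof
      fix x
      have "L x = (\<Sum>i\<in>UNIV. x $ i *s L (axis i 1))"
        by (rule linear_image_expansion[OF L])
      then show "L x = (\<Sum>i\<in>UNIV. rank_one (L (axis i 1)) (axis i 1)) x"
        by (simp only: sum_fun_apply rank_one_axis)
    qed
    also have "\<dots> \<in> \<A>"
      using \<open>U = UNIV\<close> by (intro op.subspace_sum[OF sub]) (auto simp: U_def)
    finally show ?thesis .
  qed
  then show ?thesis using alg unfolding unital_subalgebra_def by blast
qed

subsection \<open>The generated algebra\<close>

lemma subspace_lin_ops: "op.subspace (lin_ops :: ('n::finite) endo set)"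
  unfolding op.subspace_def lin_ops_def
  by (auto simp: zero_fun_def plus_fun_def op_scale_def
      intro: vec.linear_compose_add vec.linear_compose_scale_right vec.linear_zero)

lemma word_eval_append: "word_eval A (v @ w) = word_eval A v \<circ> word_eval A w"
  by (induction v) auto

text \<open>Words outside the support contribute 0. This allows summing over chosen words whose
  coefficients may vanish.\<close>

lemma ncpoly_eval_superset:
  assumes "finite W" "Poly_Mapping.keys p \<subseteq> W"
  shows "ncpoly_eval A p = (\<Sum>w\<in>W. op_scale (Poly_Mapping.lookup p w) (word_eval A w))"
  unfolding ncpoly_eval_def
  by (rule sum.mono_neutral_left[OF assms]) (simp add: in_keys_iff)

text \<open>Passing from polynomials to the span of words makes linear closure immediate and span
  induction available.\<close>

lemma gen_alg_eq_span: "gen_alg S = op.span (word_eval (\<lambda>A. A) ` lists S)"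
proof
  show "gen_alg S \<subseteq> op.span (word_eval (\<lambda>A. A) ` lists S)"
  proof
    fix X assume "X \<in> gen_alg S"
    then obtain p where p: "X = ncpoly_eval (\<lambda>A. A) p" "ncpoly_vars p \<subseteq> S"
      by (auto simp: gen_alg_def)
    have "w \<in> lists S" if "w \<in> Poly_Mapping.keys p" for w
      using p(2) that by (auto simp: ncpoly_vars_def)
    then show "X \<in> op.span (word_eval (\<lambda>A. A) ` lists S)"
      unfolding p(1) ncpoly_eval_def
      by (intro op.span_sum op.span_scale op.span_base imageI)
  qed
  show "op.span (word_eval (\<lambda>A. A) ` lists S) \<subseteq> gen_alg S"
  proof
    fix X assume "X \<in> op.span (word_eval (\<lambda>A. A) ` lists S)"
    then obtain t r where t: "finite t" "t \<subseteq> word_eval (\<lambda>A. A) ` lists S"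
      and X: "X = (\<Sum>a\<in>t. op_scale (r a) a)"
      by (auto simp: op.span_explicit)
    \<comment> \<open>Different words may evaluate to the same operator, so one word
      \<open>f a\<close> is chosen for each \<open>a\<close>; the polynomial puts the coefficient
      \<open>r a\<close> on that word only.\<close>
    from t(2) have "\<forall>a\<in>t. \<exists>w. w \<in> lists S \<and> word_eval (\<lambda>A. A) w = a"
      by blast
    from bchoice[OF this] obtain f
      where f: "\<And>a. a \<in> t \<Longrightarrow> f a \<in> lists S \<and> word_eval (\<lambda>A. A) (f a) = a"
      by blast
    have inj: "inj_on f t"
      by (rule inj_on_inverseI[of _ "word_eval (\<lambda>A. A)"]) (simp add: f)
    define g where "g w = (if w \<in> f ` t then r (word_eval (\<lambda>A. A) w) else 0)" for w
    define p where "p = Abs_poly_mapping g"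
    have "finite {w. g w \<noteq> 0}"
      by (rule finite_subset[of _ "f ` t"]) (auto simp: g_def t(1))
    then have lookup: "Poly_Mapping.lookup p = g"
      by (simp add: p_def)
    have keys: "Poly_Mapping.keys p \<subseteq> f ` t"
      by (auto simp: in_keys_iff lookup g_def split: if_splits)
    have "ncpoly_eval (\<lambda>A. A) p = X"
      using f by (simp add: ncpoly_eval_superset[OF _ keys] t(1) sum.reindex[OF inj] X lookup g_def)
    moreover have "ncpoly_vars p \<subseteq> S"
      using keys f by (fastforce simp: ncpoly_vars_def)
    ultimately show "X \<in> gen_alg S" unfolding gen_alg_def by blast
  qed
qed

lemma subset_gen_alg: "S \<subseteq> gen_alg S"
proof
  fix A assume "A \<in> S"
  then have "word_eval (\<lambda>A. A) [A] \<in> word_eval (\<lambda>A. A) ` lists S"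
    by (intro imageI) simp
  then have "word_eval (\<lambda>A. A) [A] \<in> gen_alg S"
    unfolding gen_alg_eq_span by (rule op.span_base)
  then show "A \<in> gen_alg S" by simp
qed

lemma unital_subalgebra_gen_alg:
  fixes S :: "('n::finite) endo set"
  assumes S: "S \<subseteq> lin_ops"
  shows "unital_subalgebra (gen_alg S)"
proof -
  let ?W = "word_eval (\<lambda>A. A) ` lists S"
  have "word_eval (\<lambda>A. A) w \<in> lin_ops" if "w \<in> lists S" for w
    using that
  proof (induction w)
    case Nil
    show ?case
      unfolding word_eval.simps lin_ops_def mem_Collect_eq by (rule vec.linear_id)
  next
    case (Cons A w)
    then have "Vector_Spaces.linear (*s) (*s) A" using S by (auto simp: lin_ops_def)
    with Cons.IH show ?case
      unfolding word_eval.simps lin_ops_def mem_Collect_eq by (rule Vector_Spaces.linear_compose)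
  qed
  then have sub: "gen_alg S \<subseteq> lin_ops"
    unfolding gen_alg_eq_span by (intro op.span_minimal subspace_lin_ops) auto
  have "word_eval (\<lambda>A. A) [] \<in> ?W" by blast
  then have id: "id \<in> gen_alg S" by (simp add: gen_alg_eq_span op.span_base)
  \<comment> \<open>Closure under products takes two span inductions. Here the left factor is a
    single word, and concatenation of words handles the product; distributing over the right factor
    uses linearity of \<open>A\<close>.\<close>
  have left: "A \<circ> B \<in> gen_alg S" if AW: "A \<in> ?W" and B: "B \<in> gen_alg S" for A B
  proof -
    have "A \<in> gen_alg S" using AW by (simp add: gen_alg_eq_span op.span_base)
    then have A: "Vector_Spaces.linear (*s) (*s) A" using sub by (auto simp: lin_ops_def)
    from B[unfolded gen_alg_eq_span] show ?thesis
    proof (induction rule: op.span_induct_alt)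
      case base
      have "A \<circ> (0 :: 'n endo) = 0" by (simp add: fun_eq_iff vec.linear_0[OF A])
      then show ?case by (simp only: gen_alg_eq_span op.span_zero)
    next
      case (step c B C)
      obtain v w where "A = word_eval (\<lambda>A. A) v" "v \<in> lists S"
          "B = word_eval (\<lambda>A. A) w" "w \<in> lists S"
        using AW step(1) by blast
      then have "A \<circ> B \<in> ?W"
        by (intro rev_image_eqI[of "v @ w"]) (simp_all add: word_eval_append)
      moreover have "A \<circ> (op_scale c B + C) = op_scale c (A \<circ> B) + (A \<circ> C)"
        by (simp add: fun_eq_iff vec.linear_add[OF A] vec.linear_scale[OF A])
      ultimately show ?case
        using step(2) by (simp only: gen_alg_eq_span op.span_add op.span_scale op.span_base)
    qed
  qed
  \<comment> \<open>The second induction is over the left factor, where composition distributes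
    pointwise.\<close>
  have "A \<circ> B \<in> gen_alg S" if "A \<in> gen_alg S" "B \<in> gen_alg S" for A B
    using that(1)[unfolded gen_alg_eq_span]
  proof (induction rule: op.span_induct_alt)
    case base
    have "0 \<circ> B = (0 :: 'n endo)" by (simp add: fun_eq_iff)
    then show ?case by (simp only: gen_alg_eq_span op.span_zero)
  next
    case (step c A C)
    have "(op_scale c A + C) \<circ> B = op_scale c (A \<circ> B) + (C \<circ> B)"
      by (simp add: fun_eq_iff)
    then show ?case
      using step(2) left[OF step(1) that(2)]
      by (simp only: gen_alg_eq_span op.span_add op.span_scale)
  qed
  then show ?thesis
    using sub id unfolding unital_subalgebra_def by (simp add: gen_alg_eq_span)
qed

lemma gen_alg_invariant:
  assumes V: "vec.subspace V" and inv: "\<And>A. A \<in> S \<Longrightarrow> A ` V \<subseteq> V"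
    and A: "A \<in> gen_alg S"
  shows "A ` V \<subseteq> V"
proof -
  have word: "word_eval (\<lambda>A. A) w ` V \<subseteq> V" if "w \<in> lists S" for w
    using that
  proof (induction w)
    case (Cons A w)
    then show ?case using inv[of A] by auto
  qed simp
  from A[unfolded gen_alg_eq_span] show ?thesis
  proof (induction rule: op.span_induct_alt)
    case base
    then show ?case using V by (auto simp: vec.subspace_0)
  next
    case (step c B C)
    have "B ` V \<subseteq> V" using word step(1) by auto
    then show ?case
      using step(2) by (auto intro!: vec.subspace_add[OF V] vec.subspace_scale[OF V])
  qed
qed

text \<open>A rank-one operator reading off a nonzero coordinate of some \<open>v \<in> V\<close>
  sends \<open>v\<close> to a nonzero multiple of a vector \<open>a\<close> outside
  \<open>V\<close>.\<close>

lemma lin_ops_no_invariant_subspace: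
  assumes "vec.subspace V" "V \<noteq> {0}" "V \<noteq> UNIV"
  shows "\<exists>A\<in>lin_ops. \<not> A ` V \<subseteq> V"
proof -
  obtain v where v: "v \<in> V" "v \<noteq> 0" using assms vec.subspace_0 by blast
  obtain a where a: "a \<notin> V" using assms by auto
  obtain i where i: "v $ i \<noteq> 0" using v by (auto simp: vec_eq_iff)
  have "v $ i *s a \<notin> V"
  proof
    assume "v $ i *s a \<in> V"
    then have "inverse (v $ i) *s (v $ i *s a) \<in> V" by (rule vec.subspace_scale[OF assms(1)])
    then show False using a i by simp
  qed
  then have "\<not> rank_one a (axis i 1) ` V \<subseteq> V"
    using v(1) rank_one_axis[of a i v] by (metis image_subset_iff)
  moreover have "rank_one a (axis i 1) \<in> lin_ops"
    by (simp add: lin_ops_def linear_rank_one)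
  ultimately show ?thesis by blast
qed

text \<open>The ambient space of all functions is infinite-dimensional, so the strict monotonicity of
  dimension in the library does not apply.\<close>

lemma (in vector_space) dim_psubset_finite_span:
  assumes "subspace U" "U \<subset> W" "finite T" "W \<subseteq> span T"
  shows "dim U < dim W"
proof -
  obtain B where B: "B \<subseteq> U" "independent B" "U \<subseteq> span B" "card B = dim U"
    by (rule basis_exists)
  then obtain C where C: "B \<subseteq> C" "C \<subseteq> W" "independent C" "W \<subseteq> span C"
    using maximal_independent_subset_extend[of B W] assms(2) by (metis psubset_imp_subset subset_trans)
  \<comment> \<open>\<open>card\<close> is 0 on infinite sets, so the strict comparison of the two
    bases needs \<open>C\<close> finite; the finite spanning set \<open>T\<close> bounds it.\<close>
  have "finite C"
    using independent_span_bound[OF assms(3) C(3)] C(2) assms(4) by blast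
  moreover have "B \<noteq> C"
    using span_minimal[OF B(1) assms(1)] C(4) assms(2) by blast
  ultimately have "card B < card C"
    using C(1) by (simp add: psubset_card_mono psubset_eq)
  then show ?thesis
    using B(4) basis_card_eq_dim[OF C(2) C(4) C(3)] by simp
qed

text \<open>The set \<open>?E\<close> consists of the matrix units, and the coefficients are the
  matrix entries of \<open>L\<close>.\<close>

lemma lin_ops_subset_finite_span:
  "\<exists>T. finite T \<and> (lin_ops :: ('n::finite) endo set) \<subseteq> op.span T"
proof (intro exI conjI)
  let ?E = "(\<lambda>(i, j). rank_one (axis i 1) (axis j 1 :: complex ^ 'n)) ` UNIV"
  show "finite ?E" by simp
  show "lin_ops \<subseteq> op.span ?E"
  proof
    fix L :: "'n endo" assume "L \<in> lin_ops"
    then have L: "Vector_Spaces.linear (*s) (*s) L" by (simp add: lin_ops_def)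
    have "L = (\<Sum>j\<in>UNIV. \<Sum>i\<in>UNIV. op_scale (L (axis j 1) $ i) (rank_one (axis i 1) (axis j 1)))"
    proof
      fix x
      have "(\<Sum>i\<in>UNIV. L (axis j 1) $ i *s (x $ j *s axis i 1)) = x $ j *s L (axis j 1)" for j
        by (subst (2) linear_combination_axis[of "L (axis j 1)"])
          (simp add: vec.scale_sum_right mult.commute)
      then show "L x = (\<Sum>j\<in>UNIV. \<Sum>i\<in>UNIV.
          op_scale (L (axis j 1) $ i) (rank_one (axis i 1) (axis j 1))) x"
        by (simp add: sum_fun_apply rank_one_axis linear_image_expansion[OF L, of x]
            del: vec.scale_scale)
    qed
    also have "\<dots> \<in> op.span ?E"
      by (intro op.span_sum op.span_scale op.span_base) auto
    finally show "L \<in> op.span ?E" .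
  qed
qed

subsection \<open>Hamiltonian models\<close>

lemma ham_lin_apply: "ham_lin H l x = (\<Sum>k\<in>UNIV. of_real (l $ k) *s H k x)"
  by (simp add: ham_lin_def sum_fun_apply)

lemma ham_apply: "ham H0 H l x = H0 x + ham_lin H l x"
  by (simp add: ham_def)

lemma ham_lin_0 [simp]: "ham_lin H 0 x = 0"
  by (simp add: ham_lin_apply)

lemma ham_lin_add: "ham_lin H (l + m) x = ham_lin H l x + ham_lin H m x"
  by (simp add: ham_lin_apply vec.scale_left_distrib sum.distrib)

lemma ham_lin_scaleR: "ham_lin H (r *\<^sub>R l) x = of_real r *s ham_lin H l x"
  by (simp add: ham_lin_apply vec.scale_sum_right)

text \<open>The weights sum to 1, so the constant term \<open>H0\<close> is reproduced
  exactly.\<close>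

lemma ham_affine:
  assumes "u + v = 1"
  shows "ham H0 H (u *\<^sub>R l + v *\<^sub>R m) x = of_real u *s ham H0 H l x + of_real v *s ham H0 H m x"
proof -
  have "H0 x = of_real u *s H0 x + of_real v *s H0 x"
    using assms by (metis of_real_1 of_real_add vec.scale_left_distrib vec.scale_one)
  then show ?thesis
    by (simp add: ham_apply ham_lin_add ham_lin_scaleR vec.scale_right_distrib)
qed

text \<open>\<open>M + 1\<close> affinely independent points have affine dimension \<open>M\<close>,
  that of the whole parameter space.\<close>

lemma affine_basis_affine_hull:
  assumes "affine_basis B"
  shows "affine hull B = UNIV"
proof -
  have "aff_dim B = int (CARD('a))"
    using assms aff_dim_affine_independent[of B] by (simp add: affine_basis_def)
  then show ?thesis by (simp add: aff_dim_eq_full[symmetric])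
qed

text \<open>The parameters \<open>l\<close> for which \<open>ham H0 H l\<close> preserves
  \<open>V\<close> form an affine set, and those for \<open>ham_lin H l\<close> a real linear
  subspace; hence preservation on a basis spreads to all parameters.\<close>

lemma ham_invariant_iff_coeff_invariant:
  assumes V: "vec.subspace V" and coeff: "is_coeff H0 H S"
  shows "(\<forall>l. ham H0 H l ` V \<subseteq> V) \<longleftrightarrow> (\<forall>A\<in>S. A ` V \<subseteq> V)"
proof
  assume inv: "\<forall>l. ham H0 H l ` V \<subseteq> V"
  \<comment> \<open>The linear part is the difference of the model at \<open>l\<close> and at
    \<open>0\<close>.\<close>
  have "ham_lin H l ` V \<subseteq> V" for l
  proof clarify
    fix x assume "x \<in> V"
    then have "ham H0 H l x - ham H0 H 0 x \<in> V"
      using inv by (blast intro: vec.subspace_diff[OF V])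
    then show "ham_lin H l x \<in> V" by (simp add: ham_apply)
  qed
  moreover have "S \<subseteq> range (ham_lin H) \<union> range (ham H0 H)"
    using coeff unfolding is_coeff_def by blast
  ultimately show "\<forall>A\<in>S. A ` V \<subseteq> V"
    using inv by blast
next
  assume inv: "\<forall>A\<in>S. A ` V \<subseteq> V"
  from coeff consider
      (affine) B where "affine_basis B" "S = ham H0 H ` B"
    | (linear) B C where "linear_basis C" "C \<subset> B" "S = ham_lin H ` C \<union> ham H0 H ` (B - C)"
    unfolding is_coeff_def by blast
  then show "\<forall>l. ham H0 H l ` V \<subseteq> V"
  proof cases
    case affine
    have "affine hull B \<subseteq> {l. ham H0 H l ` V \<subseteq> V}"
    proof (rule hull_minimal)
      show "B \<subseteq> {l. ham H0 H l ` V \<subseteq> V}" using inv affine by blast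
      show "affine {l. ham H0 H l ` V \<subseteq> V}"
        unfolding affine_def
        by (auto simp: ham_affine image_subset_iff intro!: vec.subspace_add[OF V] vec.subspace_scale[OF V])
    qed
    then show ?thesis using affine_basis_affine_hull[OF affine(1)] by auto
  next
    case linear
    have "span C \<subseteq> {l. ham_lin H l ` V \<subseteq> V}"
    proof (rule span_minimal)
      show "C \<subseteq> {l. ham_lin H l ` V \<subseteq> V}" using inv linear by blast
      show "subspace {l. ham_lin H l ` V \<subseteq> V}"
        unfolding subspace_def
        by (auto simp: ham_lin_add ham_lin_scaleR image_subset_iff vec.subspace_0[OF V]
            intro!: vec.subspace_add[OF V] vec.subspace_scale[OF V])
    qed
    then have lin: "ham_lin H l x \<in> V" if "x \<in> V" for l x
      using linear(1) that unfolding linear_basis_def by blast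
    \<comment> \<open>Properness of \<open>C \<subset> B\<close> supplies a base point
      \<open>b\<close> carrying the constant term; every other parameter is reached by adding
      \<open>ham_lin H (l - b)\<close>.\<close>
    obtain b where b: "b \<in> B - C" using linear(2) by blast
    show ?thesis
    proof clarify
      fix l x assume x: "x \<in> V"
      have "ham H0 H b x \<in> V" using inv linear(3) b x by blast
      moreover have "ham H0 H l x = ham H0 H b x + ham_lin H (l - b) x"
        using ham_lin_add[of H b "l - b" x] by (simp add: ham_apply)
      ultimately show "ham H0 H l x \<in> V"
        using lin[OF x] by (simp add: vec.subspace_add[OF V])
    qed
  qed
qed

lemma coeff_subset_lin_ops:
  assumes "H0 \<in> lin_ops" "\<And>k. H k \<in> lin_ops" "is_coeff H0 H S"
  shows "S \<subseteq> lin_ops"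
proof -
  have lin: "ham_lin H l \<in> lin_ops" for l
    unfolding ham_lin_def
    using assms(2) by (intro op.subspace_sum op.subspace_scale subspace_lin_ops)
  moreover have "ham H0 H l \<in> lin_ops" for l
    unfolding ham_def using assms(1) lin by (intro op.subspace_add subspace_lin_ops)
  ultimately show ?thesis using assms(3) by (auto simp: is_coeff_def)
qed

theorem proposition3p10:
  fixes H0 :: "complex ^ ('n::finite) \<Rightarrow> complex ^ 'n"
    and H :: "('m::finite) \<Rightarrow> complex ^ 'n \<Rightarrow> complex ^ 'n"
    and Coeff :: "(complex ^ 'n \<Rightarrow> complex ^ 'n) set"
  assumes "self_adjoint H0"
    and "\<And>k. self_adjoint (H k)"
    and "is_coeff H0 H Coeff"
  shows "((\<exists>V. vec.subspace V \<and> V \<noteq> {0} \<and> V \<noteq> UNIV \<and> (\<forall>l. ham H0 H l ` V \<subseteq> V))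
            \<longleftrightarrow> proper_subalgebra (gen_alg Coeff))
       \<and> (proper_subalgebra (gen_alg Coeff)
            \<longleftrightarrow> op.dim (gen_alg Coeff) < op.dim (lin_ops :: (complex ^ 'n \<Rightarrow> complex ^ 'n) set))"
proof -
  have "Coeff \<subseteq> lin_ops"
    using assms coeff_subset_lin_ops by (metis self_adjoint_def)
  then have alg: "unital_subalgebra (gen_alg Coeff)"
    by (rule unital_subalgebra_gen_alg)
  then have proper: "proper_subalgebra (gen_alg Coeff) \<longleftrightarrow> gen_alg Coeff \<noteq> lin_ops"
    by (simp add: proper_subalgebra_def)
  have inv: "(\<forall>l. ham H0 H l ` V \<subseteq> V) \<longleftrightarrow> (\<forall>A\<in>gen_alg Coeff. A ` V \<subseteq> V)"
    if "vec.subspace V" for V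
    unfolding ham_invariant_iff_coeff_invariant[OF that assms(3)]
  proof
    assume "\<forall>A\<in>Coeff. A ` V \<subseteq> V"
    then show "\<forall>A\<in>gen_alg Coeff. A ` V \<subseteq> V"
      using gen_alg_invariant[OF that, of Coeff] by simp
  next
    assume "\<forall>A\<in>gen_alg Coeff. A ` V \<subseteq> V"
    then show "\<forall>A\<in>Coeff. A ` V \<subseteq> V"
      using subset_gen_alg[of Coeff] by (meson subsetD)
  qed
  have "(\<exists>V. vec.subspace V \<and> V \<noteq> {0} \<and> V \<noteq> UNIV \<and> (\<forall>l. ham H0 H l ` V \<subseteq> V))
      \<longleftrightarrow> gen_alg Coeff \<noteq> lin_ops"
  proof
    assume "\<exists>V. vec.subspace V \<and> V \<noteq> {0} \<and> V \<noteq> UNIV \<and> (\<forall>l. ham H0 H l ` V \<subseteq> V)"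
    then obtain V where V: "vec.subspace V" "V \<noteq> {0}" "V \<noteq> UNIV" "\<forall>A\<in>gen_alg Coeff. A ` V \<subseteq> V"
      using inv by blast
    show "gen_alg Coeff \<noteq> lin_ops"
      using lin_ops_no_invariant_subspace[OF V(1-3)] V(4) by blast
  next
    assume ne: "gen_alg Coeff \<noteq> lin_ops"
    show "\<exists>V. vec.subspace V \<and> V \<noteq> {0} \<and> V \<noteq> UNIV \<and> (\<forall>l. ham H0 H l ` V \<subseteq> V)"
    proof (rule ccontr)
      assume none: "\<not> (\<exists>V. vec.subspace V \<and> V \<noteq> {0} \<and> V \<noteq> UNIV \<and> (\<forall>l. ham H0 H l ` V \<subseteq> V))"
      have "gen_alg Coeff = lin_ops"
      proof (rule Burnside[OF alg])
        fix V assume "vec.subspace V" "\<forall>A\<in>gen_alg Coeff. A ` V \<subseteq> V"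
        then show "V = {0} \<or> V = UNIV"
          using none inv[of V] by metis
      qed
      then show False using ne by contradiction
    qed
  qed
  \<comment> \<open>Different dimensions trivially force different sets, so the remaining content is
    that a proper subspace of \<open>lin_ops\<close> has strictly smaller dimension.\<close>
  moreover have "op.dim (gen_alg Coeff) < op.dim (lin_ops :: 'n endo set)" if "gen_alg Coeff \<noteq> lin_ops"
  proof -
    obtain T where "finite T" "(lin_ops :: 'n endo set) \<subseteq> op.span T"
      using lin_ops_subset_finite_span by blast
    moreover have "op.subspace (gen_alg Coeff)" "gen_alg Coeff \<subset> lin_ops"
      using alg that by (auto simp: unital_subalgebra_def)
    ultimately show ?thesis by (intro op.dim_psubset_finite_span)
  qed
  ultimately show ?thesis using proper by auto
qed

end
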